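(* There is a polynomial-time algorithm that, given a tournament graph $G=(V,E)$ on $m$ teams, a single-elimination cup $c$ with fixed, known seeding over the teams $V$, a coalition $C\subseteq V$, and a team $v_l\in V$, decides whether the cup competition can be destructively manipulated against $v_l$, i.e. whether there is a set of manipulations of the tournament by $C$ after which $v_l$ does not win the cup.
   Context: A tournament is a directed graph $G=(V,E)$ whose underlying undirected graph is complete, with exactly one directed edge between any two distinct teams; $(v_i,v_j)\in E$ means that $v_i$ beats $v_j$ in a fair game. The number of teams is $m=|V|$, and the tournament graph is known. A manipulation replaces an edge $(v_i,v_j)$ by $(v_j,v_i)$; it is allowed only if $v_i\in C$, i.e. coalition members may only throw games they would have won. A single-elimination cup with fixed seeding is a rooted binary tree in which every internal node has two children and whose leaves are labelled bijectively by the teams. Each internal node is a game between the winners of its two child subtrees (a leaf's winner is its team), decided by the (manipulated) tournament graph; the winner of the game at the root wins the cup. *)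

theory Defs
  imports Main "HOL-Computational_Algebra.Polynomial"
begin

section \<open>Cups and their manipulation\<close>

text \<open>\<open>(u, v) \<in> E\<close> means that \<open>u\<close> beats \<open>v\<close> in a fair game.\<close>

definition tournament :: "'a set \<Rightarrow> ('a \<times> 'a) set \<Rightarrow> bool" where
  "tournament V E \<longleftrightarrow> finite V \<and> E \<subseteq> V \<times> V \<and> asym E \<and> total_on V E"

datatype 'a cup = Team 'a | Game "'a cup" "'a cup"

fun seeding :: "'a cup \<Rightarrow> 'a list" where
  "seeding (Team v) = [v]"
| "seeding (Game l r) = seeding l @ seeding r"

definition cup_over :: "'a set \<Rightarrow> 'a cup \<Rightarrow> bool" where
  "cup_over V c \<longleftrightarrow> distinct (seeding c) \<and> set (seeding c) = V"

fun winner :: "('a \<times> 'a) set \<Rightarrow> 'a cup \<Rightarrow> 'a" where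
  "winner E (Team v) = v"
| "winner E (Game l r) =
     (if (winner E l, winner E r) \<in> E then winner E l else winner E r)"

text \<open>A set of manipulations is given by the set \<open>M\<close> of edges that are reversed.\<close>

definition can_throw :: "('a \<times> 'a) set \<Rightarrow> 'a set \<Rightarrow> ('a \<times> 'a) set" where
  "can_throw E C = {(u, v) \<in> E. u \<in> C}"

definition manipulate :: "('a \<times> 'a) set \<Rightarrow> ('a \<times> 'a) set \<Rightarrow> ('a \<times> 'a) set" where
  "manipulate E M = (E - M) \<union> M\<inverse>"

definition destructively_manipulable ::
    "('a \<times> 'a) set \<Rightarrow> 'a set \<Rightarrow> 'a cup \<Rightarrow> 'a \<Rightarrow> bool" where
  "destructively_manipulable E C c v \<longleftrightarrow>
     (\<exists>M \<subseteq> can_throw E C. winner (manipulate E M) c \<noteq> v)"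


section \<open>Random access machines\<close>

text \<open>
  Algorithms are programs of a random access machine in the style of Cook and Reckhow, with a
  read-only input of bits and infinitely many registers holding natural numbers, all initially 0.
  Every instruction costs one time unit. As there is no multiplication, \<open>t\<close> steps only produce
  numbers of \<open>O(t)\<close> bits, so that polynomial time on this machine is the same as polynomial time on
  Turing machines.
\<close>

datatype instr =
    Const nat nat
  | Add nat nat nat
  | Sub nat nat nat
  | Load nat nat
  | Store nat nat
  | Read nat nat
  | Jump_Zero nat nat
  | Halt bool

datatype config = Running nat "nat \<Rightarrow> nat" | Halted bool

text \<open>The symbol 2 marks the end of the input.\<close>

definition input_symbol :: "bool list \<Rightarrow> nat \<Rightarrow> nat" where
  "input_symbol xs n = (if n < length xs then of_bool (xs ! n) else 2)"

fun exec_instr :: "bool list \<Rightarrow> instr \<Rightarrow> nat \<Rightarrow> (nat \<Rightarrow> nat) \<Rightarrow> config" where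
  "exec_instr xs (Const i k) pc r = Running (Suc pc) (r(i := k))"
| "exec_instr xs (Add i j k) pc r = Running (Suc pc) (r(i := r j + r k))"
| "exec_instr xs (Sub i j k) pc r = Running (Suc pc) (r(i := r j - r k))"
| "exec_instr xs (Load i j) pc r = Running (Suc pc) (r(i := r (r j)))"
| "exec_instr xs (Store i j) pc r = Running (Suc pc) (r(r i := r j))"
| "exec_instr xs (Read i j) pc r = Running (Suc pc) (r(i := input_symbol xs (r j)))"
| "exec_instr xs (Jump_Zero i l) pc r = Running (if r i = 0 then l else Suc pc) r"
| "exec_instr xs (Halt b) pc r = Halted b"

text \<open>A machine whose program counter leaves the program is stuck and never gives an answer.\<close>

fun step :: "instr list \<Rightarrow> bool list \<Rightarrow> config \<Rightarrow> config" where
  "step prog xs (Running pc r) =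
     (if pc < length prog then exec_instr xs (prog ! pc) pc r else Running pc r)"
| "step prog xs (Halted b) = Halted b"

text \<open>\<open>Halted b\<close> is a fixed point of \<open>step\<close>, so this means halting after at most \<open>t\<close> steps.\<close>

definition answers_within :: "instr list \<Rightarrow> bool list \<Rightarrow> nat \<Rightarrow> bool \<Rightarrow> bool" where
  "answers_within prog xs t b \<longleftrightarrow> (step prog xs ^^ t) (Running 0 (\<lambda>_. 0)) = Halted b"


section \<open>Encoding of instances\<close>

text \<open>
  The teams are numbered \<open>0, \<dots>, m - 1\<close>. The tournament is given by its adjacency matrix, the
  coalition by its characteristic vector, and the cup in reverse Polish notation. Numbers can be
  written in unary: the adjacency matrix alone takes \<open>m\<^sup>2\<close> bits and the whole encoding
  has length \<open>O(m\<^sup>2)\<close>, so being polynomial in the length of the encoding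
  is the same as being polynomial in \<open>m\<close>.
\<close>

definition encode_nat :: "nat \<Rightarrow> bool list" where
  "encode_nat n = replicate n True @ [False]"

fun encode_cup :: "nat cup \<Rightarrow> bool list" where
  "encode_cup (Team v) = False # encode_nat v"
| "encode_cup (Game l r) = encode_cup l @ encode_cup r @ [True]"

definition encode_instance ::
    "nat \<Rightarrow> (nat \<times> nat) set \<Rightarrow> nat set \<Rightarrow> nat cup \<Rightarrow> nat \<Rightarrow> bool list" where
  "encode_instance m E C c v =
     encode_nat m
     @ concat (map (\<lambda>i. map (\<lambda>j. (i, j) \<in> E) [0..<m]) [0..<m])
     @ map (\<lambda>i. i \<in> C) [0..<m]
     @ encode_nat v
     @ encode_cup c"

end

theory Submission
  imports Defs
begin

text \<open>
  The teams that can be made to win a subcup are computed bottom-up: a possible winner \<open>a\<close> of one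
  side of a game can win it iff the other side has a possible winner \<open>b\<close> that \<open>a\<close> beats or that
  can throw the game. The two sides can be manipulated independently because they have no teams in
  common. The cup can be manipulated against \<open>v\<close> iff some other team is a possible winner.
  The machine scans the reverse Polish notation of the cup and maintains the stack of the sets of
  possible winners; a game costs \<open>O(m\<^sup>2)\<close> steps, so the total time is
  quadratic in the length of the input.
\<close>

section \<open>Possible winners\<close>

text \<open>The main obstacle is the machine model: the claim asks for one explicit instruction list
  with absolute jumps, together with a step count. Programs are therefore written in a small
  language of blocks, conditionals and loops whose semantics counts machine steps; once its
  compilation is verified, all reasoning is by rules for triples with a time budget. The memory has
  no room for a stack of sets as such. Since no team occurs twice in the seeding, the sets on the
  stack are pairwise disjoint, so a single array with one label per team can hold all of them. The
  machine cannot multiply. This is harmless because teams and opponents are tried in the order of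
  the rows of the adjacency matrix, so that a pointer moving one bit at a time replaces the index
  computation.\<close>

fun possible_winners :: "('a \<times> 'a) set \<Rightarrow> 'a set \<Rightarrow> 'a cup \<Rightarrow> 'a set" where
  "possible_winners E C (Team v) = {v}"
| "possible_winners E C (Game l r) =
     {a \<in> possible_winners E C l. \<exists>b \<in> possible_winners E C r. (a, b) \<in> E \<or> b \<in> C} \<union>
     {b \<in> possible_winners E C r. \<exists>a \<in> possible_winners E C l. (b, a) \<in> E \<or> a \<in> C}"

lemma possible_winners_subset: "possible_winners E C c \<subseteq> set (seeding c)"
  by (induction c) auto

lemma winner_in_seeding: "winner E c \<in> set (seeding c)"
  by (induction c) auto

text \<open>Only teams of the same subcup meet in it, so edges with an end outside cannot matter.
  This is what makes the manipulations of one side invisible on the other.\<close>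

lemma winner_cong:
  assumes "\<And>x y. x \<in> set (seeding c) \<Longrightarrow> y \<in> set (seeding c) \<Longrightarrow> (x, y) \<in> E \<longleftrightarrow> (x, y) \<in> E'"
  shows "winner E c = winner E' c"
  using assms
proof (induction c)
  case (Game l r)
  then have "winner E l = winner E' l" "winner E r = winner E' r"
    by auto
  then show ?case
    using Game.prems winner_in_seeding[of E' l] winner_in_seeding[of E' r] by simp
qed simp

text \<open>An edge present after the manipulation is either original or the reversal of a game
  thrown by its new loser. If the edge from left to right is absent, then it was either removed, so
  the left team threw the game, or it never existed, and totality gives the fair win of the right
  team.\<close>

lemma winner_possible:
  assumes "tournament V E" "M \<subseteq> can_throw E C"
    and "distinct (seeding c)" "set (seeding c) \<subseteq> V"
  shows "winner (manipulate E M) c \<in> possible_winners E C c"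
  using assms(3,4)
proof (induction c)
  case (Game l r)
  let ?a = "winner (manipulate E M) l" and ?b = "winner (manipulate E M) r"
  have "?a \<in> possible_winners E C l" "?b \<in> possible_winners E C r"
    using Game by auto
  moreover have "?a \<in> V" "?b \<in> V" "?a \<noteq> ?b"
    using Game.prems winner_in_seeding[of "manipulate E M" l] winner_in_seeding[of "manipulate E M" r]
    by auto
  then have "(?a, ?b) \<in> E \<or> (?b, ?a) \<in> E"
    using assms(1) by (auto simp: tournament_def total_on_def)
  moreover have "(?a, ?b) \<in> E \<or> ?b \<in> C" if "(?a, ?b) \<in> manipulate E M"
    using that assms(2) by (auto simp: manipulate_def can_throw_def)
  moreover have "?a \<in> C" if "(?a, ?b) \<notin> manipulate E M" "(?a, ?b) \<in> E"
    using that assms(2) by (auto simp: manipulate_def can_throw_def)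
  ultimately show ?case
    by auto
qed simp

text \<open>Since every pair of teams meets at most once, manipulations for the two subcups and for the
  game between their winners do not interfere.\<close>

lemma possible_winner_wins:
  assumes "tournament V E" "w \<in> possible_winners E C c"
    and "distinct (seeding c)" "set (seeding c) \<subseteq> V"
  shows "\<exists>M \<subseteq> can_throw E C \<inter> set (seeding c) \<times> set (seeding c). winner (manipulate E M) c = w"
  using assms(2-4)
proof (induction c arbitrary: w)
  case (Game l r)
  let ?L = "set (seeding l)" and ?R = "set (seeding r)"
  have disj: "?L \<inter> ?R = {}"
    using Game.prems by auto
  have combine: "\<exists>M \<subseteq> can_throw E C \<inter> set (seeding (Game l r)) \<times> set (seeding (Game l r)).
      winner (manipulate E M) (Game l r) = w"
    if a: "a \<in> possible_winners E C l" and b: "b \<in> possible_winners E C r"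
      and w: "w = a \<and> ((a, b) \<in> E \<or> b \<in> C) \<or> w = b \<and> ((b, a) \<in> E \<or> a \<in> C)" for a b
  proof -
    obtain M1 where M1: "M1 \<subseteq> can_throw E C \<inter> ?L \<times> ?L" "winner (manipulate E M1) l = a"
      using Game.IH(1)[OF a] Game.prems by auto
    obtain M2 where M2: "M2 \<subseteq> can_throw E C \<inter> ?R \<times> ?R" "winner (manipulate E M2) r = b"
      using Game.IH(2)[OF b] Game.prems by auto
    have ab: "a \<in> ?L" "b \<in> ?R"
      using a b possible_winners_subset by fastforce+
    then have "a \<in> V" "b \<in> V" "a \<noteq> b"
      using Game.prems disj by auto
    then have E: "(a, b) \<in> E \<longleftrightarrow> (b, a) \<notin> E"
      using assms(1) by (auto simp: tournament_def total_on_def dest: asymD)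
    \<comment> \<open>Only the edge that speaks against \<open>w\<close> is reversed; the
      intersection with \<open>E\<close> leaves \<open>X\<close> empty if \<open>w\<close> wins the
      game fairly.\<close>
    define X where "X = (if w = a then {(b, a)} \<inter> E else {(a, b)} \<inter> E)"
    define M where "M = M1 \<union> M2 \<union> X"
    have X: "X \<subseteq> can_throw E C \<inter> (?L \<times> ?R \<union> ?R \<times> ?L)"
      using w ab E \<open>a \<noteq> b\<close> by (auto simp: X_def can_throw_def)
    \<comment> \<open>Edges of \<open>X\<close> cross between the two sides and edges of
      \<open>M2\<close> stay in the right one, so none of them is a game of the left subcup.\<close>
    have "winner (manipulate E M) l = winner (manipulate E M1) l"
      using M2(1) X disj by (intro winner_cong) (auto simp: M_def manipulate_def)
    moreover have "winner (manipulate E M) r = winner (manipulate E M2) r"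
      using M1(1) X disj by (intro winner_cong) (auto simp: M_def manipulate_def)
    moreover have "(a, b) \<in> manipulate E M \<longleftrightarrow> w = a"
      using M1(1) M2(1) ab disj E w \<open>a \<noteq> b\<close>
      by (auto simp: M_def X_def manipulate_def)
    ultimately have "winner (manipulate E M) (Game l r) = w"
      using M1(2) M2(2) w by auto
    moreover have "M \<subseteq> can_throw E C \<inter> set (seeding (Game l r)) \<times> set (seeding (Game l r))"
      using M1(1) M2(1) X by (auto simp: M_def)
    ultimately show ?thesis
      by blast
  qed
  show ?case
  proof (cases "w \<in> possible_winners E C l")
    case True
    moreover from this have "w \<notin> possible_winners E C r"
      using disj possible_winners_subset by fastforce
    ultimately obtain b where "b \<in> possible_winners E C r" "(w, b) \<in> E \<or> b \<in> C"
      using Game.prems(1) by auto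
    then show ?thesis
      using True combine by blast
  next
    case False
    then obtain a where "w \<in> possible_winners E C r" "a \<in> possible_winners E C l"
      "(w, a) \<in> E \<or> a \<in> C"
      using Game.prems(1) by auto
    then show ?thesis
      using combine by blast
  qed
qed auto

lemma destructively_manipulable_iff:
  assumes "tournament V E" "cup_over V c"
  shows "destructively_manipulable E C c v \<longleftrightarrow> (\<exists>w \<in> possible_winners E C c. w \<noteq> v)"
proof -
  have c: "distinct (seeding c)" "set (seeding c) \<subseteq> V"
    using assms(2) by (auto simp: cup_over_def)
  show ?thesis
    using winner_possible[OF assms(1) _ c] possible_winner_wins[OF assms(1) _ c]
    unfolding destructively_manipulable_def by (metis inf.boundedE)
qed


section \<open>Evaluation in reverse Polish notation\<close>

text \<open>A layer between cups and bits: the stack algorithm is verified as a \<open>fold\<close>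
  over tokens, and the bits matter only for the scanner.\<close>

datatype token = Push nat | Merge

fun tokens :: "nat cup \<Rightarrow> token list" where
  "tokens (Team v) = [Push v]"
| "tokens (Game l r) = tokens l @ tokens r @ [Merge]"

fun encode_token :: "token \<Rightarrow> bool list" where
  "encode_token (Push v) = False # encode_nat v"
| "encode_token Merge = [True]"

lemma encode_cup_tokens: "encode_cup c = concat (map encode_token (tokens c))"
  by (induction c) auto

lemma tokens_neq_Nil: "tokens c \<noteq> []"
  by (induction c) auto

text \<open>The stack of sets of possible winners is represented by its height and by labelling
  every team with the level of the set it belongs to, or with 0. As labels do not exceed the height
  \<open>h\<close>, the sum of two labels is \<open>(h - 1) + h\<close> iff one of the teams is in the topmost set and the
  other one in the set below.\<close>

fun process :: "nat \<Rightarrow> (nat \<times> nat) set \<Rightarrow> nat set \<Rightarrow> token \<Rightarrow>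
    nat \<times> (nat \<Rightarrow> nat) \<Rightarrow> nat \<times> (nat \<Rightarrow> nat)" where
  "process m E C (Push v) (h, lab) = (Suc h, lab(v := Suc h))"
| "process m E C Merge (h, lab) = (h - 1, \<lambda>a.
     if \<exists>b<m. lab a + lab b = h - 1 + h \<and> ((a, b) \<in> E \<or> b \<in> C) then h - 1
     else if h - 1 \<le> lab a then 0 else lab a)"

text \<open>The induction needs an arbitrary stack underneath: its labels are at most
  \<open>h\<close> and survive outside the subcup, while the subcup contributes exactly one new
  level.\<close>

lemma process_tokens:
  assumes "distinct (seeding c)" "set (seeding c) \<subseteq> {..<m}" "\<And>u. lab u \<le> h"
  shows "fold (process m E C) (tokens c) (h, lab) =
    (Suc h, \<lambda>u. if u \<in> possible_winners E C c then Suc h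
                else if u \<in> set (seeding c) then 0 else lab u)"
  using assms
proof (induction c arbitrary: h lab)
  case (Team v)
  then show ?case by auto
next
  case (Game l r)
  let ?L = "possible_winners E C l" and ?R = "possible_winners E C r"
  define lab1 where "lab1 = (\<lambda>u. if u \<in> ?L then Suc h else if u \<in> set (seeding l) then 0 else lab u)"
  define lab2 where "lab2 =
    (\<lambda>u. if u \<in> ?R then Suc (Suc h) else if u \<in> set (seeding r) then 0 else lab1 u)"
  have le: "lab u \<le> h" for u
    using Game.prems by auto
  then have le1: "lab1 u \<le> Suc h" for u
    by (auto simp: lab1_def le_SucI)
  have fold: "fold (process m E C) (tokens l @ tokens r) (h, lab) = (Suc (Suc h), lab2)"
    using Game le le1 by (auto simp: lab1_def[symmetric] lab2_def)
  have sub: "?L \<subseteq> set (seeding l)" "?R \<subseteq> set (seeding r)" "?L \<inter> ?R = {}"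
    using possible_winners_subset[of E C l] possible_winners_subset[of E C r] Game.prems(1) by auto
  have lab2_h: "lab2 u = Suc (Suc h) \<longleftrightarrow> u \<in> ?R" "lab2 u = Suc h \<longleftrightarrow> u \<in> ?L"
    "lab2 u \<ge> Suc h \<longleftrightarrow> u \<in> ?L \<union> ?R" "lab2 u \<le> Suc (Suc h)" for u
    using le[of u] sub Game.prems(1) by (auto simp: lab2_def lab1_def)
  \<comment> \<open>Both labels are at most \<open>h + 2\<close>, so a sum of
    \<open>2 * h + 3\<close> forces both to be at least \<open>h + 1\<close>; as the sum is odd,
    they differ.\<close>
  have sum: "lab2 a + lab2 b = Suc h + Suc (Suc h) \<longleftrightarrow> a \<in> ?L \<and> b \<in> ?R \<or> a \<in> ?R \<and> b \<in> ?L" for a b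
    using lab2_h(4)[of a] lab2_h(4)[of b] unfolding lab2_h(1,2)[symmetric] by linarith
  have lt: "b < m" if "b \<in> ?L \<or> b \<in> ?R" for b
    using that sub Game.prems(2) by auto
  have "process m E C Merge (Suc (Suc h), lab2) = (Suc h, \<lambda>a.
      if \<exists>b<m. (a \<in> ?L \<and> b \<in> ?R \<or> a \<in> ?R \<and> b \<in> ?L) \<and> ((a, b) \<in> E \<or> b \<in> C) then Suc h
      else if a \<in> ?L \<union> ?R then 0 else lab2 a)"
    by (simp only: process.simps diff_Suc_1 sum lab2_h(3))
  also have "\<dots> = (Suc h, \<lambda>u. if u \<in> possible_winners E C (Game l r) then Suc h
                else if u \<in> set (seeding (Game l r)) then 0 else lab u)"
  proof (intro arg_cong[where f = "Pair (Suc h)"] ext)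
    fix u
    consider "u \<in> ?L" "u \<notin> ?R" | "u \<in> ?R" "u \<notin> ?L" | "u \<notin> ?L" "u \<notin> ?R"
      using sub(3) by blast
    then show "(if \<exists>b<m. (u \<in> ?L \<and> b \<in> ?R \<or> u \<in> ?R \<and> b \<in> ?L) \<and> ((u, b) \<in> E \<or> b \<in> C) then Suc h
      else if u \<in> ?L \<union> ?R then 0 else lab2 u) =
      (if u \<in> possible_winners E C (Game l r) then Suc h
       else if u \<in> set (seeding (Game l r)) then 0 else lab u)"
    proof cases
      case 1
      then have "u \<in> set (seeding l)"
        using sub(1) by blast
      then show ?thesis
        using 1 lt by auto
    next
      case 2
      then have "u \<in> set (seeding r)"
        using sub(2) by blast
      then show ?thesis
        using 2 lt by auto
    next
      case 3
      then show ?thesis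
        by (simp add: lab1_def lab2_def)
    qed
  qed
  finally show ?case
    using fold by simp
qed


section \<open>Structured programs with running times\<close>

fun straight :: "instr \<Rightarrow> bool" where
  "straight (Jump_Zero i l) = False"
| "straight (Halt b) = False"
| "straight _ = True"

text \<open>Turns an instruction without control flow into a function on registers, so that whole
  blocks are evaluated by simplification of a \<open>fold\<close>.\<close>

definition effect :: "bool list \<Rightarrow> instr \<Rightarrow> (nat \<Rightarrow> nat) \<Rightarrow> nat \<Rightarrow> nat" where
  "effect xs i r = (case exec_instr xs i 0 r of Running pc r' \<Rightarrow> r' | Halted b \<Rightarrow> r)"

lemma effect_simps [simp]:
  "effect xs (Const i k) r = r(i := k)"
  "effect xs (Add i j l) r = r(i := r j + r l)"
  "effect xs (Sub i j l) r = r(i := r j - r l)"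
  "effect xs (Load i j) r = r(i := r (r j))"
  "effect xs (Store i j) r = r(r i := r j)"
  "effect xs (Read i j) r = r(i := input_symbol xs (r j))"
  by (simp_all add: effect_def)

lemma exec_straight: "straight i \<Longrightarrow> exec_instr xs i pc r = Running (Suc pc) (effect xs i r)"
  by (cases i) (simp_all add: effect_def)

text \<open>Loops test after the body and thus cost a single backward jump. They run at least once,
  which is why \<open>0 < m\<close> and a nonempty token list appear as hypotheses below.\<close>

datatype com = Block "instr list" | Seq com com (infixr ";;" 60) | If_Nonzero nat com | Repeat_While_Zero com nat

fun compile :: "nat \<Rightarrow> com \<Rightarrow> instr list" where
  "compile p (Block is) = is"
| "compile p (c ;; d) = compile p c @ compile (p + length (compile p c)) d"
| "compile p (If_Nonzero i c) =
     Jump_Zero i (Suc p + length (compile (Suc p) c)) # compile (Suc p) c"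
| "compile p (Repeat_While_Zero c i) = compile p c @ [Jump_Zero i p]"

text \<open>The number is the exact count of executed instructions, with one step for each
  evaluation of a conditional jump. A derivation exists only for terminating executions.\<close>

inductive run :: "bool list \<Rightarrow> com \<Rightarrow> (nat \<Rightarrow> nat) \<Rightarrow> nat \<Rightarrow> (nat \<Rightarrow> nat) \<Rightarrow> bool" for xs where
  Block: "list_all straight is \<Longrightarrow> run xs (Block is) r (length is) (fold (effect xs) is r)"
| Seq: "run xs c r t r' \<Longrightarrow> run xs d r' u r'' \<Longrightarrow> run xs (c ;; d) r (t + u) r''"
| If_Zero: "r i = 0 \<Longrightarrow> run xs (If_Nonzero i c) r 1 r"
| If_Nonzero: "r i \<noteq> 0 \<Longrightarrow> run xs c r t r' \<Longrightarrow> run xs (If_Nonzero i c) r (Suc t) r'"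
| Repeat_Stop: "run xs c r t r' \<Longrightarrow> r' i \<noteq> 0 \<Longrightarrow> run xs (Repeat_While_Zero c i) r (Suc t) r'"
| Repeat_Continue: "run xs c r t r' \<Longrightarrow> r' i = 0 \<Longrightarrow> run xs (Repeat_While_Zero c i) r' u r''
    \<Longrightarrow> run xs (Repeat_While_Zero c i) r (Suc t + u) r''"

section \<open>Correctness of the compilation\<close>

lemma step_nth:
  "prog = pre @ i # post \<Longrightarrow> step prog xs (Running (length pre) r) = exec_instr xs i (length pre) r"
  by simp

lemma funpow_add_apply: "(f ^^ t) x = y \<Longrightarrow> (f ^^ u) y = z \<Longrightarrow> (f ^^ (t + u)) x = z"
  by (simp add: funpow_add add.commute[of t u])

lemma funpow_Suc_apply: "f x = y \<Longrightarrow> (f ^^ u) y = z \<Longrightarrow> (f ^^ Suc u) x = z"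
  by (simp add: funpow_swap1)

lemma steps_block:
  "list_all straight is \<Longrightarrow> prog = pre @ is @ post \<Longrightarrow>
   (step prog xs ^^ length is) (Running (length pre) r) =
     Running (length pre + length is) (fold (effect xs) is r)"
proof (induction "is" arbitrary: pre r)
  case (Cons i "is")
  have "step prog xs (Running (length pre) r) = Running (Suc (length pre)) (effect xs i r)"
    using Cons.prems by (subst step_nth[of _ pre i "is @ post"]) (auto simp: exec_straight)
  moreover have "(step prog xs ^^ length is) (Running (length (pre @ [i])) (effect xs i r)) =
      Running (length (pre @ [i]) + length is) (fold (effect xs) is (effect xs i r))"
    using Cons.prems by (intro Cons.IH) auto
  ultimately show ?case
    by (simp add: funpow_swap1)
qed simp

text \<open>The code may stand anywhere in a larger program: \<open>pre\<close> and
  \<open>post\<close> are arbitrary because, for a subcommand, the code of its neighbours becomes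
  part of the context.\<close>

lemma steps_compile:
  assumes "run xs c r t r'" "prog = pre @ compile (length pre) c @ post"
  shows "(step prog xs ^^ t) (Running (length pre) r) =
    Running (length pre + length (compile (length pre) c)) r'"
  using assms
proof (induction arbitrary: pre post rule: run.induct)
  case (Block "is" r)
  then show ?case
    by (simp add: steps_block)
next
  case (Seq c r t r' d u r'')
  let ?pre = "pre @ compile (length pre) c"
  have "(step prog xs ^^ t) (Running (length pre) r) = Running (length ?pre) r'"
    using Seq.IH(1)[of pre "compile (length ?pre) d @ post"] Seq.prems by simp
  moreover have "(step prog xs ^^ u) (Running (length ?pre) r') =
      Running (length ?pre + length (compile (length ?pre) d)) r''"
    using Seq.prems by (intro Seq.IH(2)) simp
  ultimately show ?case
    by (simp add: funpow_add_apply add.assoc)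
next
  case (If_Zero r i c)
  then show ?case
    by simp
next
  case (If_Nonzero r i c t r')
  let ?pre = "pre @ [Jump_Zero i (Suc (length pre) + length (compile (Suc (length pre)) c))]"
  have "step prog xs (Running (length pre) r) = Running (length ?pre) r"
    using If_Nonzero by simp
  moreover have "(step prog xs ^^ t) (Running (length ?pre) r) =
      Running (length ?pre + length (compile (length ?pre) c)) r'"
    using If_Nonzero.prems by (intro If_Nonzero.IH) simp
  ultimately have "(step prog xs ^^ Suc t) (Running (length pre) r) =
      Running (length ?pre + length (compile (length ?pre) c)) r'"
    by (rule funpow_Suc_apply)
  then show ?case
    by (simp del: funpow.simps)
next
  case (Repeat_Stop c r t r' i)
  let ?pre = "pre @ compile (length pre) c"
  have prog: "prog = pre @ compile (length pre) c @ Jump_Zero i (length pre) # post"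
    using Repeat_Stop.prems by simp
  have "(step prog xs ^^ t) (Running (length pre) r) = Running (length ?pre) r'"
    using Repeat_Stop.IH[OF prog] by (simp only: length_append)
  moreover have "step prog xs (Running (length ?pre) r') = Running (Suc (length ?pre)) r'"
    using Repeat_Stop.hyps step_nth[of prog ?pre "Jump_Zero i (length pre)" post] prog by simp
  ultimately show ?case
    by simp
next
  case (Repeat_Continue c r t r' i u r'')
  let ?pre = "pre @ compile (length pre) c"
  have prog: "prog = pre @ compile (length pre) c @ Jump_Zero i (length pre) # post"
    using Repeat_Continue.prems by simp
  have "(step prog xs ^^ t) (Running (length pre) r) = Running (length ?pre) r'"
    using Repeat_Continue.IH(1)[OF prog] by (simp only: length_append)
  moreover have "step prog xs (Running (length ?pre) r') = Running (length pre) r'"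
    using Repeat_Continue.hyps step_nth[of prog ?pre "Jump_Zero i (length pre)" post] prog by simp
  ultimately have "(step prog xs ^^ Suc t) (Running (length pre) r) = Running (length pre) r'"
    by simp
  \<comment> \<open>The jump leads back to the address where the loop began, so the remaining rounds
    run in the same context.\<close>
  from funpow_add_apply[OF this Repeat_Continue.IH(2)[OF Repeat_Continue.prems]] show ?case .
qed

text \<open>A total correctness triple for one initial state. The budget is only an upper bound, so
  branches of different cost can share it.\<close>

definition terminates ::
    "bool list \<Rightarrow> com \<Rightarrow> nat \<Rightarrow> (nat \<Rightarrow> nat) \<Rightarrow> ((nat \<Rightarrow> nat) \<Rightarrow> bool) \<Rightarrow> bool" where
  "terminates xs c t r Q \<longleftrightarrow> (\<exists>t' r'. run xs c r t' r' \<and> t' \<le> t \<and> Q r')"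

lemma terminates_mono:
  "terminates xs c t r P \<Longrightarrow> t \<le> u \<Longrightarrow> (\<And>r'. P r' \<Longrightarrow> Q r') \<Longrightarrow> terminates xs c u r Q"
  unfolding terminates_def by (meson order_trans)

lemma terminates_Block:
  "list_all straight is \<Longrightarrow> length is \<le> t \<Longrightarrow> Q (fold (effect xs) is r) \<Longrightarrow>
   terminates xs (Block is) t r Q"
  unfolding terminates_def using run.Block by blast

lemma terminates_Seq:
  assumes "terminates xs c t r P" "\<And>r'. P r' \<Longrightarrow> terminates xs d u r' Q" "t + u \<le> s"
  shows "terminates xs (c ;; d) s r Q"
proof -
  obtain t' r' where c: "run xs c r t' r'" "t' \<le> t" "P r'"
    using assms(1) by (auto simp: terminates_def)
  obtain u' r'' where d: "run xs d r' u' r''" "u' \<le> u" "Q r''"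
    using assms(2)[OF c(3)] by (auto simp: terminates_def)
  have "t' + u' \<le> s"
    using c(2) d(2) assms(3) by linarith
  then show ?thesis
    using run.Seq[OF c(1) d(1)] d(3) unfolding terminates_def by blast
qed

lemma terminates_If:
  assumes "r i \<noteq> 0 \<Longrightarrow> terminates xs c t r Q" "r i = 0 \<Longrightarrow> Q r"
  shows "terminates xs (If_Nonzero i c) (Suc t) r Q"
proof (cases "r i = 0")
  case True
  then show ?thesis
    unfolding terminates_def using run.If_Zero[of r i xs c] assms(2) by fastforce
next
  case False
  then show ?thesis
    using assms(1) run.If_Nonzero[of r i xs c] unfolding terminates_def by (metis Suc_le_mono)
qed

text \<open>The number \<open>n\<close> of rounds is known to the proof in advance, and the body has
  to show that the tested register vanishes exactly while rounds remain. The \<open>Suc\<close> pays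
  for the jump of each round.\<close>

lemma terminates_Repeat:
  assumes "I 0 r" "0 < n"
    and "\<And>k r. k < n \<Longrightarrow> I k r \<Longrightarrow>
      terminates xs c t r (\<lambda>r'. I (Suc k) r' \<and> (r' i = 0 \<longleftrightarrow> Suc k < n))"
  shows "terminates xs (Repeat_While_Zero c i) (n * Suc t) r (I n)"
proof -
  \<comment> \<open>Induction on the rounds still to come, \<open>Suc k\<close> of them, starting
    from the last one.\<close>
  have "terminates xs (Repeat_While_Zero c i) (Suc k * Suc t) r (I n)"
    if "Suc k \<le> n" "I (n - Suc k) r" for k r
    using that
  proof (induction k arbitrary: r)
    case 0
    then obtain t' r' where "run xs c r t' r'" "t' \<le> t" "I n r'" "r' i \<noteq> 0"
      using assms(3)[of "n - 1" r] by (auto simp: terminates_def)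
    then show ?case
      using run.Repeat_Stop[of xs c r t' r' i] by (auto simp: terminates_def)
  next
    case (Suc k)
    have "n - Suc (Suc k) < n" "Suc (n - Suc (Suc k)) = n - Suc k" "n - Suc k < n"
      using Suc.prems by auto
    then obtain t' r' where 1: "run xs c r t' r'" "t' \<le> t" "I (n - Suc k) r'" "r' i = 0"
      using assms(3)[of "n - Suc (Suc k)" r] Suc.prems by (auto simp: terminates_def)
    obtain u r'' where 2: "run xs (Repeat_While_Zero c i) r' u r''" "u \<le> Suc k * Suc t" "I n r''"
      using Suc.IH[OF _ 1(3)] Suc.prems by (auto simp: terminates_def)
    have "Suc t' + u \<le> Suc (Suc k) * Suc t"
      using 1(2) 2(2) by simp
    then show ?case
      using run.Repeat_Continue[OF 1(1,4) 2(1)] 2(3) unfolding terminates_def by blast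
  qed
  from this[of "n - 1" r] show ?thesis
    using assms(1,2) by simp
qed

section \<open>From terminating commands to answers of the machine\<close>

lemma answers_within_mono:
  assumes "answers_within prog xs t b" "t \<le> u"
  shows "answers_within prog xs u b"
proof -
  have "(step prog xs ^^ k) (Halted b) = Halted b" for k
    by (induction k) auto
  then show ?thesis
    using funpow_add_apply[of t "step prog xs" "Running 0 (\<lambda>_. 0)" "Halted b" "u - t"] assms
    by (simp add: answers_within_def)
qed

definition decision_program :: "com \<Rightarrow> nat \<Rightarrow> instr list" where
  "decision_program c i = compile 0 c @ [Jump_Zero i (length (compile 0 c) + 2), Halt True, Halt False]"

text \<open>The two extra steps are the final jump and one of the two \<open>Halt\<close>
  instructions behind it.\<close>

lemma answers_within_decision_program:
  assumes "terminates xs c t (\<lambda>_. 0) (\<lambda>r. r i \<noteq> 0 \<longleftrightarrow> b)"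
  shows "answers_within (decision_program c i) xs (t + 2) b"
proof -
  let ?p = "decision_program c i"
  obtain t' r where c: "run xs c (\<lambda>_. 0) t' r" "t' \<le> t" "r i \<noteq> 0 \<longleftrightarrow> b"
    using assms by (auto simp: terminates_def)
  have "(step ?p xs ^^ t') (Running 0 (\<lambda>_. 0)) = Running (length (compile 0 c)) r"
    using steps_compile[OF c(1), of ?p "[]"] by (simp add: decision_program_def)
  moreover have "(step ?p xs ^^ 2) (Running (length (compile 0 c)) r) = Halted b"
    using c(3) by (cases b) (simp_all add: numeral_2_eq_2 decision_program_def nth_append)
  ultimately have "answers_within ?p xs (t' + 2) b"
    unfolding answers_within_def by (rule funpow_add_apply)
  then show ?thesis
    by (rule answers_within_mono) (simp add: c(2))
qed

lemma terminates_Seq_Block: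
  "list_all straight is \<Longrightarrow> terminates xs d u (fold (effect xs) is r) Q \<Longrightarrow> length is + u \<le> t \<Longrightarrow>
   terminates xs (Block is ;; d) t r Q"
  by (rule terminates_Seq[where P = "\<lambda>r'. r' = fold (effect xs) is r" and t = "length is"])
    (simp_all add: terminates_Block)


section \<open>The decision procedure as a program\<close>

text \<open>\<open>ZERO\<close> is never written to, and arrays are stored from address \<open>MEMORY\<close> on.\<close>

abbreviation (input) "ZERO \<equiv> 0 :: nat"
abbreviation (input) "ONE \<equiv> 1 :: nat"
abbreviation (input) "POS \<equiv> 2 :: nat"
abbreviation (input) "SYM \<equiv> 3 :: nat"
abbreviation (input) "TEST \<equiv> 4 :: nat"
abbreviation (input) "SIZE \<equiv> 5 :: nat"
abbreviation (input) "EDGES \<equiv> 6 :: nat"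
abbreviation (input) "COAL \<equiv> 7 :: nat"
abbreviation (input) "TEAM \<equiv> 8 :: nat"
abbreviation (input) "LABELS \<equiv> 9 :: nat"
abbreviation (input) "HEIGHT \<equiv> 10 :: nat"
abbreviation (input) "BELOW \<equiv> 11 :: nat"
abbreviation (input) "TARGET \<equiv> 12 :: nat"
abbreviation (input) "LIMIT \<equiv> 13 :: nat"
abbreviation (input) "EDGE_PTR \<equiv> 14 :: nat"
abbreviation (input) "OUTER_PTR \<equiv> 15 :: nat"
abbreviation (input) "LABEL \<equiv> 16 :: nat"
abbreviation (input) "FOUND \<equiv> 17 :: nat"
abbreviation (input) "INNER_PTR \<equiv> 18 :: nat"
abbreviation (input) "COAL_PTR \<equiv> 19 :: nat"
abbreviation (input) "OTHER \<equiv> 20 :: nat"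
abbreviation (input) "TMP1 \<equiv> 21 :: nat"
abbreviation (input) "TMP2 \<equiv> 22 :: nat"
abbreviation (input) "ADDRESS \<equiv> 23 :: nat"
abbreviation (input) "COUNTER \<equiv> 24 :: nat"
abbreviation (input) "MEMORY \<equiv> 25 :: nat"

section \<open>Reading numbers from the input\<close>

lemma input_symbol_append:
  "input_symbol (pre @ x # post) (length pre) = of_bool x"
  by (simp add: input_symbol_def)

lemma input_symbol_segment:
  assumes "k < length ys"
  shows "input_symbol (pre @ ys @ post) (length pre + k) = of_bool (ys ! k)"
  using assms by (simp add: input_symbol_def nth_append)

text \<open>The number is added to \<open>d\<close> instead of assigned: the same loop then reads a
  size into a register holding 0 and moves an address forward by a team number.\<close>

definition read_unary :: "nat \<Rightarrow> com" where
  "read_unary d = Repeat_While_Zero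
     (Block [Read SYM POS, Add POS POS ONE, Add d d SYM, Sub TEST ONE SYM]) TEST"

lemma read_unary:
  assumes xs: "xs = pre @ encode_nat n @ post"
    and r: "r POS = length pre" "r ONE = 1" and d: "d \<notin> {ONE, POS, SYM, TEST}"
  shows "terminates xs (read_unary d) (Suc n * 5) r
    (\<lambda>r'. r' POS = length pre + Suc n \<and> r' d = r d + n \<and>
          (\<forall>i. i \<notin> {POS, SYM, TEST, d} \<longrightarrow> r' i = r i))"
proof -
  \<comment> \<open>The last of the \<open>Suc n\<close> rounds consumes the terminating bit and
    adds 0, hence \<open>min k n\<close>.\<close>
  define I where "I k r' \<longleftrightarrow> r' POS = length pre + k \<and> r' d = r d + min k n \<and>
    (\<forall>i. i \<notin> {POS, SYM, TEST, d} \<longrightarrow> r' i = r i)" for k r'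
  have sym: "input_symbol xs (length pre + k) = of_bool (k < n)" if "k < Suc n" for k
    using that input_symbol_segment[of k "encode_nat n" pre post]
    by (simp add: xs encode_nat_def nth_append)
  have "terminates xs (read_unary d) (Suc n * Suc 4) r (I (Suc n))"
    unfolding read_unary_def
  proof (rule terminates_Repeat)
    show "I 0 r"
      using r by (simp add: I_def)
  next
    fix k r'
    assume "k < Suc n" "I k r'"
    then show "terminates xs (Block [Read SYM POS, Add POS POS ONE, Add d d SYM, Sub TEST ONE SYM]) 4 r'
        (\<lambda>r'. I (Suc k) r' \<and> (r' TEST = 0 \<longleftrightarrow> Suc k < Suc n))"
      using r d sym[of k] by (intro terminates_Block) (auto simp: I_def)
  qed simp
  then show ?thesis
    by (rule terminates_mono) (auto simp: I_def)
qed

text \<open>The increment of \<open>FOUND\<close> is the truncated difference of the number of reasons for which the game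
  can be won and \<open>2 * \<bar>LABEL + OTHER - TARGET\<bar>\<close>: it is positive iff the two labels
  add up to \<open>TARGET\<close> and there is a reason.\<close>

definition search_body :: "instr list" where
  "search_body =
     [Load OTHER INNER_PTR,
      Add TMP1 LABEL OTHER, Sub TEST TMP1 TARGET, Sub TMP2 TARGET TMP1, Add TEST TEST TMP2, Add TEST TEST TEST,
      Read TMP2 EDGE_PTR, Read TMP1 COAL_PTR, Add TMP2 TMP2 TMP1, Sub TMP2 TMP2 TEST,
      Add FOUND FOUND TMP2,
      Add INNER_PTR INNER_PTR ONE, Add COAL_PTR COAL_PTR ONE, Add EDGE_PTR EDGE_PTR ONE,
      Add TEST INNER_PTR ONE, Sub TEST TEST LIMIT]"

definition search :: com where
  "search = Block [Add FOUND ZERO ZERO, Add INNER_PTR LABELS ZERO, Add COAL_PTR COAL ZERO] ;;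
     Repeat_While_Zero (Block search_body) TEST"

abbreviation "search_registers \<equiv>
  {OTHER, TMP1, TMP2, TEST, FOUND, INNER_PTR, COAL_PTR, EDGE_PTR}"

text \<open>\<open>e\<close> is the row of the matrix for the team under consideration and
  \<open>c\<close> the coalition vector. The bound on \<open>r LABELS\<close> keeps the array apart
  from the scratch registers, whose changes would otherwise destroy labels.\<close>

lemma search:
  assumes e: "\<And>j. j < m \<Longrightarrow> input_symbol xs (r EDGE_PTR + j) = of_bool (e j)"
    and c: "\<And>j. j < m \<Longrightarrow> input_symbol xs (r COAL + j) = of_bool (c j)"
    and lab: "\<And>j. j < m \<Longrightarrow> r (r LABELS + j) = lab j"
    and r: "r ZERO = 0" "r ONE = 1" "r LIMIT = r LABELS + m" "MEMORY \<le> r LABELS" and m: "0 < m"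
  shows "terminates xs search (20 * m) r
    (\<lambda>r'. (r' FOUND \<noteq> 0 \<longleftrightarrow> (\<exists>j<m. r LABEL + lab j = r TARGET \<and> (e j \<or> c j))) \<and>
          r' EDGE_PTR = r EDGE_PTR + m \<and> (\<forall>i. i \<notin> search_registers \<longrightarrow> r' i = r i))"
proof -
  define I where "I k r' \<longleftrightarrow>
      (r' FOUND \<noteq> 0 \<longleftrightarrow> (\<exists>j<k. r LABEL + lab j = r TARGET \<and> (e j \<or> c j))) \<and>
      r' EDGE_PTR = r EDGE_PTR + k \<and> r' INNER_PTR = r LABELS + k \<and> r' COAL_PTR = r COAL + k \<and>
      (\<forall>i. i \<notin> search_registers \<longrightarrow> r' i = r i)" for k and r' :: "nat \<Rightarrow> nat"
  have body: "terminates xs (Block search_body) 16 r' (\<lambda>r'. I (Suc k) r' \<and> (r' TEST = 0 \<longleftrightarrow> Suc k < m))"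
    if k: "k < m" and I: "I k r'" for k r'
  proof (rule terminates_Block)
    have frame: "\<And>i. i \<notin> search_registers \<Longrightarrow> r' i = r i"
      using I by (simp add: I_def)
    have ptr: "r' EDGE_PTR = r EDGE_PTR + k" "r' INNER_PTR = r LABELS + k" "r' COAL_PTR = r COAL + k"
      using I by (simp_all add: I_def)
    have other: "r' (r LABELS + k) = lab k"
      using frame[of "r LABELS + k"] lab[OF k] r(4) by auto
    have regs: "r' ONE = 1" "r' LABEL = r LABEL" "r' TARGET = r TARGET" "r' LIMIT = r LABELS + m"
      using frame r by auto
    define s where "s = fold (effect xs) search_body r'"
    have s: "s FOUND = r' FOUND + (of_bool (e k) + of_bool (c k) -
          (r LABEL + lab k - r TARGET + (r TARGET - (r LABEL + lab k)) +
           (r LABEL + lab k - r TARGET + (r TARGET - (r LABEL + lab k)))))"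
      "s EDGE_PTR = r EDGE_PTR + Suc k" "s INNER_PTR = r LABELS + Suc k" "s COAL_PTR = r COAL + Suc k"
      "s TEST = r LABELS + k + 1 + 1 - (r LABELS + m)"
      using regs ptr other e[OF k] c[OF k] by (simp_all add: s_def search_body_def)
    have sf: "s i = r i" if "i \<notin> search_registers" for i
      using that frame[OF that] by (simp add: s_def search_body_def)
    \<comment> \<open>There are at most two reasons, and a wrong sum is off by at least 1; this is
      why doubling the deviation suffices to cancel them.\<close>
    have "s FOUND \<noteq> 0 \<longleftrightarrow> r' FOUND \<noteq> 0 \<or> r LABEL + lab k = r TARGET \<and> (e k \<or> c k)"
      unfolding s(1) by (cases "e k"; cases "c k") auto
    then have "s FOUND \<noteq> 0 \<longleftrightarrow> (\<exists>j<Suc k. r LABEL + lab j = r TARGET \<and> (e j \<or> c j))"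
      using I unfolding I_def less_Suc_eq by blast
    then have "I (Suc k) s"
      using s(2-4) sf unfolding I_def by blast
    \<comment> \<open>With truncated subtraction, \<open>x + 1 - y\<close> is 0 iff
      \<open>x < y\<close>; here it is \<open>k + 2 - m\<close>. All counting loops below test in
      this way.\<close>
    then show "I (Suc k) s \<and> (s TEST = 0 \<longleftrightarrow> Suc k < m)"
      using s(5) by auto
  qed (simp_all add: search_body_def)
  \<comment> \<open>Three instructions of setup, then 16 and a jump per round; \<open>0 < m\<close>
    absorbs the setup into \<open>20 * m\<close>.\<close>
  have "terminates xs search (3 + m * Suc 16) r (I m)"
    unfolding search_def
  proof (rule terminates_Seq_Block)
    show "terminates xs (Repeat_While_Zero (Block search_body) TEST) (m * Suc 16)
      (fold (effect xs) [Add FOUND ZERO ZERO, Add INNER_PTR LABELS ZERO, Add COAL_PTR COAL ZERO] r) (I m)"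
      by (rule terminates_Repeat[OF _ m body]) (auto simp: I_def r)
  qed simp_all
  then show ?thesis
    by (rule terminates_mono) (use m in \<open>auto simp: I_def\<close>)
qed

text \<open>The language has no alternative branch. The clearing of the label comes first and is
  overwritten if the team was found to win, which gives the priority demanded by
  \<open>process\<close>.\<close>

definition relabel :: com where
  "relabel = Block [Add TEST LABEL ONE, Sub TEST TEST BELOW] ;;
     If_Nonzero TEST (Block [Add LABEL ZERO ZERO]) ;;
     If_Nonzero FOUND (Block [Add LABEL BELOW ZERO])"

lemma relabel:
  assumes "r ZERO = 0" "r ONE = 1"
  shows "terminates xs relabel 6 r
    (\<lambda>r'. r' LABEL = (if r FOUND \<noteq> 0 then r BELOW else if r BELOW \<le> r LABEL then 0 else r LABEL) \<and>
          (\<forall>i. i \<notin> {TEST, LABEL} \<longrightarrow> r' i = r i))"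
  unfolding relabel_def
proof (rule terminates_Seq_Block)
  let ?r = "fold (effect xs) [Add TEST LABEL ONE, Sub TEST TEST BELOW] r"
  let ?P = "\<lambda>r'. r' LABEL = (if r BELOW \<le> r LABEL then 0 else r LABEL) \<and>
    (\<forall>i. i \<notin> {TEST, LABEL} \<longrightarrow> r' i = r i)"
  show "terminates xs (If_Nonzero TEST (Block [Add LABEL ZERO ZERO]) ;;
     If_Nonzero FOUND (Block [Add LABEL BELOW ZERO])) (Suc 1 + Suc 1) ?r (\<lambda>r'. r' LABEL =
       (if r FOUND \<noteq> 0 then r BELOW else if r BELOW \<le> r LABEL then 0 else r LABEL) \<and>
       (\<forall>i. i \<notin> {TEST, LABEL} \<longrightarrow> r' i = r i))"
  proof (rule terminates_Seq[where P = ?P])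
    show "terminates xs (If_Nonzero TEST (Block [Add LABEL ZERO ZERO])) (Suc 1) ?r ?P"
      using assms by (intro terminates_If terminates_Block) auto
    show "terminates xs (If_Nonzero FOUND (Block [Add LABEL BELOW ZERO])) (Suc 1) r' (\<lambda>r'. r' LABEL =
       (if r FOUND \<noteq> 0 then r BELOW else if r BELOW \<le> r LABEL then 0 else r LABEL) \<and>
       (\<forall>i. i \<notin> {TEST, LABEL} \<longrightarrow> r' i = r i))" if "?P r'" for r'
      using assms that by (intro terminates_If terminates_Block) auto
  qed simp
qed simp_all

text \<open>The offset \<open>Suc m\<close> is the length of the unary code of \<open>m\<close>. The
  address \<open>r LABELS\<close> is left open because every merge moves the array.\<close>

definition machine_state :: "nat \<Rightarrow> nat \<Rightarrow> nat \<times> (nat \<Rightarrow> nat) \<Rightarrow> (nat \<Rightarrow> nat) \<Rightarrow> bool" where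
  "machine_state m v s r \<longleftrightarrow>
     r ZERO = 0 \<and> r ONE = 1 \<and> r SIZE = m \<and> r EDGES = Suc m \<and> r COAL = Suc m + m * m \<and> r TEAM = v \<and>
     MEMORY \<le> r LABELS \<and> r HEIGHT = fst s \<and> (\<forall>u<m. r (r LABELS + u) = snd s u)"

definition graph_input :: "nat \<Rightarrow> (nat \<times> nat) set \<Rightarrow> nat set \<Rightarrow> bool list \<Rightarrow> bool" where
  "graph_input m E C xs \<longleftrightarrow>
     (\<forall>a<m. \<forall>b<m. input_symbol xs (Suc m + a * m + b) = of_bool ((a, b) \<in> E)) \<and>
     (\<forall>b<m. input_symbol xs (Suc m + m * m + b) = of_bool (b \<in> C))"

definition merge_body :: com where
  "merge_body = Block [Load LABEL OUTER_PTR] ;; search ;; relabel ;;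
     Block [Add ADDRESS OUTER_PTR SIZE, Store ADDRESS LABEL,
       Add OUTER_PTR OUTER_PTR ONE, Add TEST OUTER_PTR ONE, Sub TEST TEST LIMIT]"

text \<open>The new labels are written to fresh memory behind the old ones, since all of them depend on
  the old labels.\<close>

definition merge :: com where
  "merge = Block [Sub BELOW HEIGHT ONE, Add TARGET BELOW HEIGHT, Add LIMIT LABELS SIZE,
       Add EDGE_PTR EDGES ZERO, Add OUTER_PTR LABELS ZERO] ;;
     Repeat_While_Zero merge_body TEST ;;
     Block [Add LABELS LIMIT ZERO, Add HEIGHT BELOW ZERO]"

abbreviation "merge_registers \<equiv> search_registers \<union> {OUTER_PTR, LABEL, ADDRESS}"

text \<open>The search moves \<open>EDGE_PTR\<close> by exactly \<open>m\<close>, so it already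
  points to the row of the next team. The store goes beyond the old array, hence later rounds still
  see the old labels.\<close>

lemma merge_body:
  assumes xs: "graph_input m E C xs" and a: "a < m"
    and r: "r ZERO = 0" "r ONE = 1" "r SIZE = m" "r COAL = Suc m + m * m" "MEMORY \<le> r LABELS"
      "r BELOW = h - 1" "r TARGET = h - 1 + h" "r LIMIT = r LABELS + m"
      "r EDGE_PTR = Suc m + a * m" "r OUTER_PTR = r LABELS + a"
      "\<And>u. u < m \<Longrightarrow> r (r LABELS + u) = lab u"
  shows "terminates xs merge_body (12 + 20 * m) r (\<lambda>r'.
    r' EDGE_PTR = Suc m + Suc a * m \<and> r' OUTER_PTR = r LABELS + Suc a \<and>
    r' (r LABELS + m + a) = snd (process m E C Merge (h, lab)) a \<and>
    (\<forall>i. i \<notin> merge_registers \<union> {r LABELS + m + a} \<longrightarrow> r' i = r i) \<and> (r' TEST = 0 \<longleftrightarrow> Suc a < m))"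
  (is "terminates _ _ _ _ ?Q")
  unfolding merge_body_def
proof (rule terminates_Seq_Block)
  let ?r = "fold (effect xs) [Load LABEL OUTER_PTR] r"
  let ?b = "Block [Add ADDRESS OUTER_PTR SIZE, Store ADDRESS LABEL,
       Add OUTER_PTR OUTER_PTR ONE, Add TEST OUTER_PTR ONE, Sub TEST TEST LIMIT]"
  let ?found = "\<exists>j<m. lab a + lab j = h - 1 + h \<and> ((a, j) \<in> E \<or> j \<in> C)"
  show "terminates xs (search ;; relabel ;; ?b) (20 * m + (6 + 5)) ?r ?Q"
  proof (rule terminates_Seq)
    show "terminates xs search (20 * m) ?r (\<lambda>r'.
      (r' FOUND \<noteq> 0 \<longleftrightarrow> (\<exists>j<m. ?r LABEL + lab j = ?r TARGET \<and> ((a, j) \<in> E \<or> j \<in> C))) \<and>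
          r' EDGE_PTR = ?r EDGE_PTR + m \<and> (\<forall>i. i \<notin> search_registers \<longrightarrow> r' i = ?r i))"
      using xs a r by (intro search) (auto simp: graph_input_def)
  next
    fix r1
    assume r1: "(r1 FOUND \<noteq> 0 \<longleftrightarrow> (\<exists>j<m. ?r LABEL + lab j = ?r TARGET \<and> ((a, j) \<in> E \<or> j \<in> C))) \<and>
          r1 EDGE_PTR = ?r EDGE_PTR + m \<and> (\<forall>i. i \<notin> search_registers \<longrightarrow> r1 i = ?r i)"
    have found: "r1 FOUND \<noteq> 0 \<longleftrightarrow> ?found"
      using r1 r a by simp
    have f1: "r1 i = r i" if "i \<notin> merge_registers" for i
      using r1 that by simp
    have r1s: "r1 EDGE_PTR = Suc m + Suc a * m" "r1 OUTER_PTR = r LABELS + a" "r1 LABEL = lab a"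
      using r1 r a by simp_all
    show "terminates xs (relabel ;; ?b) (6 + 5) r1 ?Q"
    proof (rule terminates_Seq)
      show "terminates xs relabel 6 r1 (\<lambda>r'. r' LABEL =
        (if r1 FOUND \<noteq> 0 then r1 BELOW else if r1 BELOW \<le> r1 LABEL then 0 else r1 LABEL) \<and>
          (\<forall>i. i \<notin> {TEST, LABEL} \<longrightarrow> r' i = r1 i))"
        using f1 r by (intro relabel) auto
    next
      fix r2
      assume r2: "r2 LABEL =
        (if r1 FOUND \<noteq> 0 then r1 BELOW else if r1 BELOW \<le> r1 LABEL then 0 else r1 LABEL) \<and>
          (\<forall>i. i \<notin> {TEST, LABEL} \<longrightarrow> r2 i = r1 i)"
      have lab2: "r2 LABEL = snd (process m E C Merge (h, lab)) a"
        using r2 r(6) f1[of BELOW] unfolding found r1s(3) process.simps snd_conv by force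
      have f2: "r2 i = r i" if "i \<notin> merge_registers" for i
        using r2 f1[OF that] that by simp
      have r2s: "r2 EDGE_PTR = Suc m + Suc a * m" "r2 OUTER_PTR = r LABELS + a"
        using r2 r1s by simp_all
      have c: "r2 SIZE = m" "r2 ONE = 1" "r2 LIMIT = r LABELS + m"
        using f2 r by auto
      show "terminates xs ?b 5 r2 ?Q"
      proof (rule terminates_Block)
        show "?Q (fold (effect xs) [Add ADDRESS OUTER_PTR SIZE, Store ADDRESS LABEL,
          Add OUTER_PTR OUTER_PTR ONE, Add TEST OUTER_PTR ONE, Sub TEST TEST LIMIT] r2)"
          using lab2 f2 r2s c r(5) by (auto simp del: process.simps simp: ac_simps)
      qed simp_all
    qed simp
  qed simp
qed simp_all

lemma merge:
  assumes xs: "graph_input m E C xs" and m: "0 < m" and r: "machine_state m v s r"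
  shows "terminates xs merge (40 * (m * (m + 1))) r
    (\<lambda>r'. machine_state m v (process m E C Merge s) r' \<and> r' POS = r POS \<and> r' SYM = r SYM)"
proof -
  obtain h lab where s: "s = (h, lab)"
    by fastforce
  have lab: "r (r LABELS + u) = lab u" if "u < m" for u
    using r that by (simp add: machine_state_def s)
  have regs: "r ZERO = 0" "r ONE = 1" "r SIZE = m" "r EDGES = Suc m" "r COAL = Suc m + m * m"
    "MEMORY \<le> r LABELS" "r HEIGHT = h" "r TEAM = v"
    using r by (simp_all add: machine_state_def s)
  let ?is = "[Sub BELOW HEIGHT ONE, Add TARGET BELOW HEIGHT, Add LIMIT LABELS SIZE,
    Add EDGE_PTR EDGES ZERO, Add OUTER_PTR LABELS ZERO]"
  define r0 where "r0 = fold (effect xs) ?is r"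
  have r0: "r0 BELOW = h - 1" "r0 TARGET = h - 1 + h" "r0 LIMIT = r LABELS + m"
    "r0 EDGE_PTR = Suc m" "r0 OUTER_PTR = r LABELS"
    using regs by (simp_all add: r0_def)
  have f0: "r0 i = r i" if "i \<notin> {BELOW, TARGET, LIMIT, EDGE_PTR, OUTER_PTR}" for i
    using that by (simp add: r0_def)
  define new where "new = snd (process m E C Merge (h, lab))"
  \<comment> \<open>Below \<open>r LABELS + m\<close> lie the registers and the old array, which
    must survive up to scratch registers; beyond it only the labels already written are
    known.\<close>
  define I where "I a r' \<longleftrightarrow> r' EDGE_PTR = Suc m + a * m \<and> r' OUTER_PTR = r LABELS + a \<and>
      (\<forall>u<a. r' (r LABELS + m + u) = new u) \<and>
      (\<forall>i. i \<notin> merge_registers \<and> i < r LABELS + m \<longrightarrow> r' i = r0 i)" for a and r' :: "nat \<Rightarrow> nat"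
  have loop: "terminates xs (Repeat_While_Zero merge_body TEST) (m * Suc (12 + 20 * m)) r0 (I m)"
  proof (rule terminates_Repeat)
    show "I 0 r0"
      using r0 by (simp add: I_def)
  next
    fix a r'
    assume a: "a < m" and I: "I a r'"
    have frame: "r' i = r0 i" if "i \<notin> merge_registers" "i < r LABELS + m" for i
      using I that by (simp add: I_def)
    have regs': "r' ZERO = 0" "r' ONE = 1" "r' SIZE = m" "r' COAL = Suc m + m * m" "r' LABELS = r LABELS"
      "r' BELOW = h - 1" "r' TARGET = h - 1 + h" "r' LIMIT = r' LABELS + m"
      using frame f0 r0 regs by simp_all
    have ptrs: "r' EDGE_PTR = Suc m + a * m" "r' OUTER_PTR = r LABELS + a"
      using I by (simp_all add: I_def)
    have lab': "r' (r LABELS + u) = lab u" if "u < m" for u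
      using that regs(6) lab by (subst frame) (auto simp: f0)
    show "terminates xs merge_body (12 + 20 * m) r' (\<lambda>r''. I (Suc a) r'' \<and> (r'' TEST = 0 \<longleftrightarrow> Suc a < m))"
    proof (rule terminates_mono)
      show "terminates xs merge_body (12 + 20 * m) r' (\<lambda>r''.
        r'' EDGE_PTR = Suc m + Suc a * m \<and> r'' OUTER_PTR = r' LABELS + Suc a \<and>
        r'' (r' LABELS + m + a) = snd (process m E C Merge (h, lab)) a \<and>
        (\<forall>i. i \<notin> merge_registers \<union> {r' LABELS + m + a} \<longrightarrow> r'' i = r' i) \<and> (r'' TEST = 0 \<longleftrightarrow> Suc a < m))"
        using regs regs' ptrs lab' by (intro merge_body xs a) simp_all
    next
      fix r''
      assume "r'' EDGE_PTR = Suc m + Suc a * m \<and> r'' OUTER_PTR = r' LABELS + Suc a \<and>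
        r'' (r' LABELS + m + a) = snd (process m E C Merge (h, lab)) a \<and>
        (\<forall>i. i \<notin> merge_registers \<union> {r' LABELS + m + a} \<longrightarrow> r'' i = r' i) \<and> (r'' TEST = 0 \<longleftrightarrow> Suc a < m)"
      then have 1: "r'' EDGE_PTR = Suc m + Suc a * m" "r'' OUTER_PTR = r LABELS + Suc a"
        "r'' (r LABELS + m + a) = new a" "r'' TEST = 0 \<longleftrightarrow> Suc a < m"
        and 2: "\<And>i. i \<notin> merge_registers \<Longrightarrow> i \<noteq> r LABELS + m + a \<Longrightarrow> r'' i = r' i"
        unfolding regs'(5) new_def by blast+
      have "r'' (r LABELS + m + u) = new u" if "u < Suc a" for u
      proof (cases "u = a")
        case False
        then have "r'' (r LABELS + m + u) = r' (r LABELS + m + u)"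
          using regs(6) by (intro 2) auto
        then show ?thesis
          using False that I by (simp add: I_def)
      qed (use 1(3) in simp)
      moreover have "r'' i = r0 i" if "i \<notin> merge_registers" "i < r LABELS + m" for i
        using 2[OF that(1)] frame[OF that] that(2) by simp
      ultimately show "I (Suc a) r'' \<and> (r'' TEST = 0 \<longleftrightarrow> Suc a < m)"
        using 1 unfolding I_def by blast
    qed simp
  qed (rule m)
  have finish: "terminates xs (Block [Add LABELS LIMIT ZERO, Add HEIGHT BELOW ZERO]) 2 r'
      (\<lambda>r'. machine_state m v (process m E C Merge s) r' \<and> r' POS = r POS \<and> r' SYM = r SYM)"
    if I: "I m r'" for r'
  proof (rule terminates_Block)
    have frame: "r' i = r0 i" if "i \<notin> merge_registers" "i < r LABELS + m" for i
      using I that by (simp add: I_def)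
    have regs': "r' ZERO = 0" "r' ONE = 1" "r' SIZE = m" "r' EDGES = Suc m" "r' COAL = Suc m + m * m"
      "r' TEAM = v" "r' BELOW = h - 1" "r' LIMIT = r LABELS + m" "r' POS = r POS" "r' SYM = r SYM"
      using frame f0 r0 regs by simp_all
    have new: "r' (r LABELS + m + u) = snd (process m E C Merge s) u" if "u < m" for u
      using I that by (simp add: I_def new_def s)
    have "fst (process m E C Merge s) = h - 1"
      by (simp add: s)
    then show "machine_state m v (process m E C Merge s)
        (fold (effect xs) [Add LABELS LIMIT ZERO, Add HEIGHT BELOW ZERO] r') \<and>
      fold (effect xs) [Add LABELS LIMIT ZERO, Add HEIGHT BELOW ZERO] r' POS = r POS \<and>
      fold (effect xs) [Add LABELS LIMIT ZERO, Add HEIGHT BELOW ZERO] r' SYM = r SYM"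
      using regs' new regs(6) by (simp add: machine_state_def del: process.simps)
  qed simp_all
  show ?thesis
    unfolding merge_def
  proof (rule terminates_Seq_Block)
    show "terminates xs (Repeat_While_Zero merge_body TEST ;; Block [Add LABELS LIMIT ZERO, Add HEIGHT BELOW ZERO])
       (m * Suc (12 + 20 * m) + 2) (fold (effect xs) ?is r)
       (\<lambda>r'. machine_state m v (process m E C Merge s) r' \<and> r' POS = r POS \<and> r' SYM = r SYM)"
      unfolding r0_def[symmetric] by (rule terminates_Seq[OF loop finish]) simp_all
    \<comment> \<open>The sum is \<open>20 * m * m + 13 * m + 7\<close>; this inequality absorbs the
      constant term.\<close>
    have "7 \<le> 7 * m"
      using m by simp
    then show "length ?is + (m * Suc (12 + 20 * m) + 2) \<le> 40 * (m * (m + 1))"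
      by (simp add: algebra_simps)
  qed simp
qed

section \<open>Leaves of the cup\<close>

definition push :: com where
  "push = Block [Add ADDRESS LABELS ZERO] ;; read_unary ADDRESS ;;
     Block [Add HEIGHT HEIGHT ONE, Store ADDRESS HEIGHT]"

text \<open>Reading the number into a copy of the base address of the array yields the cell of the
  team directly. The height is raised before it is stored, so levels start at 1 and 0 remains free
  for teams in no set.\<close>

lemma push:
  assumes xs: "xs = pre @ encode_nat u @ post" "r POS = length pre" and r: "machine_state m v s r"
  shows "terminates xs push (8 + 5 * u) r
    (\<lambda>r'. machine_state m v (process m E C (Push u) s) r' \<and> r' POS = length pre + Suc u)"
    (is "terminates _ _ _ _ ?Q")
  unfolding push_def
proof (rule terminates_Seq_Block)
  let ?r = "fold (effect xs) [Add ADDRESS LABELS ZERO] r"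
  have regs: "r ZERO = 0" "r ONE = 1"
    using r by (simp_all add: machine_state_def)
  show "terminates xs (read_unary ADDRESS ;; Block [Add HEIGHT HEIGHT ONE, Store ADDRESS HEIGHT])
      (Suc u * 5 + 2) ?r ?Q"
  proof (rule terminates_Seq)
    show "terminates xs (read_unary ADDRESS) (Suc u * 5) ?r
      (\<lambda>r'. r' POS = length pre + Suc u \<and> r' ADDRESS = ?r ADDRESS + u \<and>
          (\<forall>i. i \<notin> {POS, SYM, TEST, ADDRESS} \<longrightarrow> r' i = ?r i))"
      using xs regs by (intro read_unary) auto
    fix r'
    assume r': "r' POS = length pre + Suc u \<and> r' ADDRESS = ?r ADDRESS + u \<and>
          (\<forall>i. i \<notin> {POS, SYM, TEST, ADDRESS} \<longrightarrow> r' i = ?r i)"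
    obtain h lab where s: "s = (h, lab)"
      by fastforce
    have "r' ADDRESS = r LABELS + u"
      using r' regs by simp
    then show "terminates xs (Block [Add HEIGHT HEIGHT ONE, Store ADDRESS HEIGHT]) 2 r' ?Q"
      using r r' by (intro terminates_Block) (auto simp: machine_state_def s)
  qed simp
qed simp_all

section \<open>Locating the components of the input\<close>

definition initialize :: com where
  "initialize = Block [Const ONE 1, Const LABELS MEMORY] ;; read_unary SIZE ;;
     Block [Add EDGES POS ZERO] ;;
     Repeat_While_Zero
       (Block [Add POS POS SIZE, Add COUNTER COUNTER ONE, Add TEST COUNTER ONE, Sub TEST TEST SIZE]) TEST ;;
     Block [Add COAL POS ZERO, Add POS POS SIZE] ;; read_unary TEAM ;; Block [Read SYM POS]"

text \<open>Skipping the matrix by \<open>m\<close> additions of \<open>m\<close> to the position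
  also replaces the missing multiplication. Labels, height and all accumulators are correct from the
  start, since registers initially hold 0.\<close>

lemma initialize:
  assumes xs: "xs = encode_nat m @ graph @ encode_nat v @ post" "length graph = m * m + m"
    and m: "0 < m"
  shows "terminates xs initialize (20 + 10 * m + 5 * v) (\<lambda>_. 0)
    (\<lambda>r. machine_state m v (0, \<lambda>_. 0) r \<and> r POS = Suc m + m * m + m + Suc v \<and>
         r SYM = input_symbol xs (r POS))" (is "terminates _ _ _ _ ?Q")
  unfolding initialize_def
proof (rule terminates_Seq_Block)
  let ?r = "fold (effect xs) [Const ONE 1, Const LABELS MEMORY] (\<lambda>_. 0)"
  let ?b = "Block [Add POS POS SIZE, Add COUNTER COUNTER ONE, Add TEST COUNTER ONE, Sub TEST TEST SIZE]"
  let ?c3 = "read_unary TEAM ;; Block [Read SYM POS]"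
  let ?c2 = "Repeat_While_Zero ?b TEST ;; Block [Add COAL POS ZERO, Add POS POS SIZE] ;; ?c3"
  let ?c1 = "Block [Add EDGES POS ZERO] ;; ?c2"
  have r: "?r ONE = 1" "?r LABELS = MEMORY" "\<And>i. i \<notin> {ONE, LABELS} \<Longrightarrow> ?r i = 0"
    by simp_all
  let ?t3 = "Suc v * 5 + 1"
  let ?t2 = "m * Suc 4 + (2 + ?t3)"
  let ?t1 = "1 + ?t2"
  show "terminates xs (read_unary SIZE ;; ?c1) (Suc m * 5 + ?t1) ?r ?Q"
  proof (rule terminates_Seq)
    show "terminates xs (read_unary SIZE) (Suc m * 5) ?r
      (\<lambda>r'. r' POS = length ([] :: bool list) + Suc m \<and> r' SIZE = ?r SIZE + m \<and>
          (\<forall>i. i \<notin> {POS, SYM, TEST, SIZE} \<longrightarrow> r' i = ?r i))"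
      using xs(1) by (intro read_unary[where post = "graph @ encode_nat v @ post"]) simp_all
  next
    fix r1
    assume "r1 POS = length ([] :: bool list) + Suc m \<and> r1 SIZE = ?r SIZE + m \<and>
          (\<forall>i. i \<notin> {POS, SYM, TEST, SIZE} \<longrightarrow> r1 i = ?r i)"
    then have r1: "r1 POS = Suc m" "r1 SIZE = m" "r1 ONE = 1" "r1 LABELS = MEMORY"
      "\<And>i. i \<notin> {POS, SYM, TEST, SIZE, ONE, LABELS} \<Longrightarrow> r1 i = 0"
      by simp_all
    show "terminates xs ?c1 ?t1 r1 ?Q"
    proof (rule terminates_Seq_Block)
      let ?r2 = "fold (effect xs) [Add EDGES POS ZERO] r1"
      define I where "I k r \<longleftrightarrow> r POS = Suc m + k * m \<and> r COUNTER = k \<and>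
        (\<forall>i. i \<notin> {POS, COUNTER, TEST} \<longrightarrow> r i = ?r2 i)" for k r
      show "terminates xs ?c2 ?t2 ?r2 ?Q"
      proof (rule terminates_Seq)
        show "terminates xs (Repeat_While_Zero ?b TEST) (m * Suc 4) ?r2 (I m)"
        proof (rule terminates_Repeat)
          show "I 0 ?r2"
            using r1 by (simp add: I_def)
        next
          fix k r
          assume "k < m" "I k r"
          then show "terminates xs ?b 4 r (\<lambda>r'. I (Suc k) r' \<and> (r' TEST = 0 \<longleftrightarrow> Suc k < m))"
            using r1 by (intro terminates_Block) (auto simp: I_def)
        qed (rule m)
      next
        fix r2
        assume "I m r2"
        then have r2: "r2 POS = Suc m + m * m" "r2 SIZE = m" "r2 ONE = 1" "r2 LABELS = MEMORY"
          "r2 EDGES = Suc m"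
          "\<And>i. i \<notin> {POS, SYM, TEST, SIZE, ONE, LABELS, COUNTER, EDGES} \<Longrightarrow> r2 i = 0"
          using r1 by (simp_all add: I_def)
        show "terminates xs (Block [Add COAL POS ZERO, Add POS POS SIZE] ;; ?c3) (2 + ?t3) r2 ?Q"
        proof (rule terminates_Seq_Block)
          let ?r3 = "fold (effect xs) [Add COAL POS ZERO, Add POS POS SIZE] r2"
          show "terminates xs ?c3 ?t3 ?r3 ?Q"
          proof (rule terminates_Seq)
            show "terminates xs (read_unary TEAM) (Suc v * 5) ?r3
              (\<lambda>r'. r' POS = length (encode_nat m @ graph) + Suc v \<and> r' TEAM = ?r3 TEAM + v \<and>
                (\<forall>i. i \<notin> {POS, SYM, TEST, TEAM} \<longrightarrow> r' i = ?r3 i))"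
              using xs r2 by (intro read_unary[where post = post]) (auto simp: encode_nat_def)
          next
            fix r4
            assume "r4 POS = length (encode_nat m @ graph) + Suc v \<and> r4 TEAM = ?r3 TEAM + v \<and>
                (\<forall>i. i \<notin> {POS, SYM, TEST, TEAM} \<longrightarrow> r4 i = ?r3 i)"
            then have "r4 POS = Suc m + m * m + m + Suc v" "r4 TEAM = v" "r4 SIZE = m" "r4 ONE = 1"
              "r4 LABELS = MEMORY" "r4 EDGES = Suc m" "r4 COAL = Suc m + m * m" "r4 HEIGHT = 0"
              "r4 ZERO = 0" "\<And>i. MEMORY \<le> i \<Longrightarrow> r4 i = 0"
              using r2 xs(2) by (simp_all add: encode_nat_def)
            then show "terminates xs (Block [Read SYM POS]) 1 r4 ?Q"
              by (intro terminates_Block) (auto simp: machine_state_def)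
          qed simp
        qed simp_all
      qed simp
    qed simp_all
  qed simp
qed simp_all

text \<open>On entry \<open>SYM\<close> holds the first bit of the token. Merging preserves it, so
  the second test still sees the same bit; reading a number destroys it, but comes last. The final
  difference \<open>SYM - 1\<close> is positive only for the end marker 2.\<close>

definition process_token :: com where
  "process_token = Block [Add POS POS ONE] ;; If_Nonzero SYM merge ;;
     Block [Sub TEST ONE SYM] ;; If_Nonzero TEST push ;; Block [Read SYM POS, Sub TEST SYM ONE]"

lemma process_token:
  assumes xs: "xs = pre @ encode_token x @ post" and graph: "graph_input m E C xs" and m: "0 < m"
    and r: "machine_state m v s r" "r POS = length pre" "r SYM = input_symbol xs (r POS)"
  shows "terminates xs process_token (15 + 40 * (m * (m + 1)) + 5 * length xs) r
    (\<lambda>r'. machine_state m v (process m E C x s) r' \<and> r' POS = length (pre @ encode_token x) \<and>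
          r' SYM = input_symbol xs (r' POS) \<and> (r' TEST = 0 \<longleftrightarrow> post \<noteq> []))" (is "terminates _ _ _ _ ?Q")
proof -
  have update: "machine_state m v s (r(i := k))" if "machine_state m v s r" "i \<in> {POS, SYM, TEST}" for i k s r
    using that by (auto simp: machine_state_def)
  let ?b = "Block [Read SYM POS, Sub TEST SYM ONE]"
  let ?c2 = "If_Nonzero TEST push ;; ?b"
  let ?c1 = "Block [Sub TEST ONE SYM] ;; ?c2"
  have finish: "terminates xs ?b 2 r' ?Q"
    if "machine_state m v (process m E C x s) r'" "r' POS = length (pre @ encode_token x)" for r'
  proof (rule terminates_Block)
    \<comment> \<open>The lookahead for the next round: behind the last token it is the end marker,
      otherwise a proper bit.\<close>
    have "input_symbol xs (length (pre @ encode_token x)) = (if post = [] then 2 else of_bool (hd post))"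
    proof (cases post)
      case (Cons y ys)
      then show ?thesis
        using input_symbol_append[of "pre @ encode_token x" y ys] by (simp add: xs)
    qed (simp add: xs input_symbol_def)
    moreover have "r' ONE = 1"
      using that(1) by (simp add: machine_state_def)
    ultimately show "?Q (fold (effect xs) [Read SYM POS, Sub TEST SYM ONE] r')"
      using that by (auto simp: update)
  qed simp_all
  show ?thesis
    unfolding process_token_def
  proof (rule terminates_Seq_Block)
    let ?r = "fold (effect xs) [Add POS POS ONE] r"
    have one: "r ONE = 1"
      using r(1) by (simp add: machine_state_def)
    then have r0: "machine_state m v s ?r" "?r POS = Suc (length pre)" "?r SYM = of_bool (x = Merge)"
      "?r ONE = 1"
      using r xs by (cases x; simp add: update input_symbol_append)+
    show "terminates xs (If_Nonzero SYM merge ;; ?c1)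
        (Suc (40 * (m * (m + 1))) + (1 + (Suc (8 + 5 * length xs) + 2))) ?r ?Q"
    proof (cases x)
      case (Push u)
      show ?thesis
      proof (rule terminates_Seq)
        show "terminates xs (If_Nonzero SYM merge) (Suc (40 * (m * (m + 1)))) ?r (\<lambda>r'. r' = ?r)"
          using r0 Push by (intro terminates_If) simp_all
        \<comment> \<open>The unary code of \<open>u\<close> is part of the input; this gives all
          tokens the same budget.\<close>
        have "u \<le> length xs"
          by (simp add: xs Push encode_nat_def)
        have "terminates xs push (8 + 5 * u) (?r(TEST := 1)) (\<lambda>r'.
            machine_state m v (process m E C (Push u) s) r' \<and> r' POS = length (pre @ [False]) + Suc u)"
          using r0 xs Push by (intro push update) simp_all
        then have push: "terminates xs push (8 + 5 * length xs) (?r(TEST := 1)) (\<lambda>r'.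
            machine_state m v (process m E C x s) r' \<and> r' POS = length (pre @ encode_token x))"
          by (rule terminates_mono) (use Push \<open>u \<le> length xs\<close> in \<open>simp_all add: encode_nat_def\<close>)
        have "terminates xs ?c1 (1 + (Suc (8 + 5 * length xs) + 2)) ?r ?Q"
        proof (rule terminates_Seq_Block)
          have "fold (effect xs) [Sub TEST ONE SYM] ?r = ?r(TEST := 1)"
            using r0(3,4) Push by simp
          then show "terminates xs ?c2 (Suc (8 + 5 * length xs) + 2) (fold (effect xs) [Sub TEST ONE SYM] ?r) ?Q"
            by (simp only:) (rule terminates_Seq[OF terminates_If[OF push] finish], simp_all)
        qed simp_all
        then show "terminates xs ?c1 (1 + (Suc (8 + 5 * length xs) + 2)) r' ?Q" if "r' = ?r" for r'
          using that by simp
      qed simp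
    next
      case Merge
      show ?thesis
      proof (rule terminates_Seq)
        let ?P = "\<lambda>r'. machine_state m v (process m E C Merge s) r' \<and> r' POS = ?r POS \<and> r' SYM = ?r SYM"
        show "terminates xs (If_Nonzero SYM merge) (Suc (40 * (m * (m + 1)))) ?r ?P"
          by (rule terminates_If, rule merge[OF graph m r0(1)]) (use r0 Merge in simp)
        fix r'
        assume r': "?P r'"
        then have one: "r' ONE = 1"
          by (simp add: machine_state_def)
        have SYM: "r' SYM = 1"
          using r' r0(3) Merge by simp
        have POS: "r' POS = length (pre @ encode_token x)"
          using r' r0(2) Merge by simp
        show "terminates xs ?c1 (1 + (Suc (8 + 5 * length xs) + 2)) r' ?Q"
        proof (rule terminates_Seq_Block)
          have eq: "fold (effect xs) [Sub TEST ONE SYM] r' = r'(TEST := 0)"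
            using one SYM by simp
          have skip: "terminates xs (If_Nonzero TEST push) (Suc (8 + 5 * length xs)) (r'(TEST := 0))
              (\<lambda>r''. r'' = r'(TEST := 0))"
            by (rule terminates_If) simp_all
          have last: "terminates xs ?b 2 (r'(TEST := 0)) ?Q"
            using r' Merge POS by (intro finish) (simp_all add: update)
          show "terminates xs ?c2 (Suc (8 + 5 * length xs) + 2)
              (fold (effect xs) [Sub TEST ONE SYM] r') ?Q"
            unfolding eq by (rule terminates_Seq[OF skip]) (erule ssubst, rule last, simp)
        qed simp_all
      qed simp
    qed
  qed simp_all
qed

section \<open>The final test on the labels\<close>

definition search_other :: com where
  "search_other =
     Block [Add ADDRESS LABELS TEAM, Store ADDRESS ZERO, Add FOUND ZERO ZERO,
       Add INNER_PTR LABELS ZERO, Add LIMIT LABELS SIZE] ;;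
     Repeat_While_Zero (Block [Load OTHER INNER_PTR, Add FOUND FOUND OTHER,
       Add INNER_PTR INNER_PTR ONE, Add TEST INNER_PTR ONE, Sub TEST TEST LIMIT]) TEST"

text \<open>After the label of \<open>v\<close> is erased, the sum of all labels is positive iff
  another team carries one, so no comparison with \<open>v\<close> is made inside the loop.\<close>

lemma search_other:
  assumes r: "machine_state m v s r" and m: "0 < m"
  shows "terminates xs search_other (5 + 6 * m) r
    (\<lambda>r'. r' FOUND \<noteq> 0 \<longleftrightarrow> (\<exists>u<m. u \<noteq> v \<and> snd s u \<noteq> 0))"
  unfolding search_other_def
proof (rule terminates_Seq_Block)
  let ?b = "Block [Load OTHER INNER_PTR, Add FOUND FOUND OTHER,
    Add INNER_PTR INNER_PTR ONE, Add TEST INNER_PTR ONE, Sub TEST TEST LIMIT]"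
  let ?r = "fold (effect xs) [Add ADDRESS LABELS TEAM, Store ADDRESS ZERO, Add FOUND ZERO ZERO,
    Add INNER_PTR LABELS ZERO, Add LIMIT LABELS SIZE] r"
  have regs: "r ZERO = 0" "r ONE = 1" "r SIZE = m" "r TEAM = v" "MEMORY \<le> r LABELS"
    "\<And>u. u < m \<Longrightarrow> r (r LABELS + u) = snd s u"
    using r by (simp_all add: machine_state_def)
  define r1 where "r1 = ?r"
  have r0: "r1 ONE = 1" "r1 LIMIT = r LABELS + m" "r1 FOUND = 0" "r1 INNER_PTR = r LABELS"
    using regs(1-5) by (simp_all add: r1_def)
  have lab: "r1 (r LABELS + u) = (if u = v then 0 else snd s u)" if "u < m" for u
    using regs that by (auto simp: r1_def)
  define I where "I k r' \<longleftrightarrow> (r' FOUND \<noteq> 0 \<longleftrightarrow> (\<exists>u<k. u \<noteq> v \<and> snd s u \<noteq> 0)) \<and>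
    r' INNER_PTR = r LABELS + k \<and> (\<forall>i. i \<notin> {OTHER, FOUND, INNER_PTR, TEST} \<longrightarrow> r' i = r1 i)" for k and r' :: "nat \<Rightarrow> nat"
  have "terminates xs (Repeat_While_Zero ?b TEST) (m * Suc 5) r1 (I m)"
  proof (rule terminates_Repeat)
    show "I 0 r1"
      using r0(3,4) by (simp add: I_def)
  next
    fix k r'
    assume k: "k < m" and I: "I k r'"
    have frame: "r' i = r1 i" if "i \<notin> {OTHER, FOUND, INNER_PTR, TEST}" for i
      using I that unfolding I_def by blast
    have "r' (r LABELS + k) = (if k = v then 0 else snd s k)"
      unfolding lab[OF k, symmetric] using regs(5) by (intro frame) auto
    moreover have "r' ONE = 1" "r' LIMIT = r LABELS + m"
      using frame[of ONE] frame[of LIMIT] r0(1,2) by simp_all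
    moreover have "r' INNER_PTR = r LABELS + k"
      using I unfolding I_def by blast
    ultimately have s: "fold (effect xs) [Load OTHER INNER_PTR, Add FOUND FOUND OTHER,
        Add INNER_PTR INNER_PTR ONE, Add TEST INNER_PTR ONE, Sub TEST TEST LIMIT] r' =
      r'(OTHER := if k = v then 0 else snd s k, FOUND := r' FOUND + (if k = v then 0 else snd s k),
         INNER_PTR := r LABELS + Suc k, TEST := Suc (Suc k) - m)"
      by (simp add: fun_eq_iff)
    have "r' FOUND + (if k = v then 0 else snd s k) \<noteq> 0 \<longleftrightarrow> (\<exists>u<Suc k. u \<noteq> v \<and> snd s u \<noteq> 0)"
      using I unfolding I_def less_Suc_eq by auto
    then show "terminates xs ?b 5 r' (\<lambda>r'. I (Suc k) r' \<and> (r' TEST = 0 \<longleftrightarrow> Suc k < m))"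
      using frame by (intro terminates_Block, simp, simp) (simp only: s, auto simp: I_def)
  qed (rule m)
  then have "terminates xs (Repeat_While_Zero ?b TEST) (6 * m) r1
      (\<lambda>r'. r' FOUND \<noteq> 0 \<longleftrightarrow> (\<exists>u<m. u \<noteq> v \<and> snd s u \<noteq> 0))"
    by (rule terminates_mono) (simp_all add: I_def)
  then show "terminates xs (Repeat_While_Zero ?b TEST) (6 * m) ?r
      (\<lambda>r'. r' FOUND \<noteq> 0 \<longleftrightarrow> (\<exists>u<m. u \<noteq> v \<and> snd s u \<noteq> 0))"
    by (simp only: r1_def)
qed simp_all

section \<open>The complete procedure\<close>

definition decide_manipulable :: com where
  "decide_manipulable = initialize ;; Repeat_While_Zero process_token TEST ;; search_other"

lemma decide_manipulable:
  assumes xs: "xs = encode_nat m @ graph @ encode_nat v @ concat (map encode_token toks)"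
    and graph: "length graph = m * m + m" "graph_input m E C xs" and m: "0 < m" and toks: "toks \<noteq> []"
  shows "terminates xs decide_manipulable
    (25 + 16 * m + 5 * v + length toks * (16 + 40 * (m * (m + 1)) + 5 * length xs)) (\<lambda>_. 0)
    (\<lambda>r. r FOUND \<noteq> 0 \<longleftrightarrow> (\<exists>u<m. u \<noteq> v \<and> snd (fold (process m E C) toks (0, \<lambda>_. 0)) u \<noteq> 0))"
  unfolding decide_manipulable_def
proof (rule terminates_Seq[OF initialize[OF xs graph(1) m]])
  define pre where "pre k = encode_nat m @ graph @ encode_nat v @ concat (map encode_token (take k toks))" for k
  define post where "post k = concat (map encode_token (drop k toks))" for k
  define I where "I k r \<longleftrightarrow> machine_state m v (fold (process m E C) (take k toks) (0, \<lambda>_. 0)) r \<and>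
    r POS = length (pre k) \<and> r SYM = input_symbol xs (r POS)" for k r
  let ?t = "15 + 40 * (m * (m + 1)) + 5 * length xs"
  fix r
  assume r: "machine_state m v (0, \<lambda>_. 0) r \<and> r POS = Suc m + m * m + m + Suc v \<and>
    r SYM = input_symbol xs (r POS)"
  have loop: "terminates xs (Repeat_While_Zero process_token TEST) (length toks * Suc ?t) r (I (length toks))"
  proof (rule terminates_Repeat)
    show "I 0 r"
      using r graph(1) by (simp add: I_def pre_def encode_nat_def)
  next
    fix k r'
    assume k: "k < length toks" and I: "I k r'"
    have "toks = take k toks @ toks ! k # drop (Suc k) toks"
      by (rule id_take_nth_drop[OF k])
    then have "concat (map encode_token toks) =
        concat (map encode_token (take k toks @ toks ! k # drop (Suc k) toks))"
      by simp
    then have input: "xs = pre k @ encode_token (toks ! k) @ post (Suc k)"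
      by (simp add: xs pre_def post_def)
    have pre: "pre k @ encode_token (toks ! k) = pre (Suc k)"
      using k by (simp add: pre_def take_Suc_conv_app_nth)
    \<comment> \<open>Since no code is empty, the input is exhausted exactly when the tokens are, so
      the machine stops correctly without knowing their number.\<close>
    have "encode_token x \<noteq> []" for x
      by (cases x) simp_all
    then have post: "post (Suc k) \<noteq> [] \<longleftrightarrow> Suc k < length toks"
      using k by (auto simp: post_def)
    have "terminates xs process_token ?t r' (\<lambda>r''.
        machine_state m v (process m E C (toks ! k) (fold (process m E C) (take k toks) (0, \<lambda>_. 0))) r'' \<and>
        r'' POS = length (pre k @ encode_token (toks ! k)) \<and>
        r'' SYM = input_symbol xs (r'' POS) \<and> (r'' TEST = 0 \<longleftrightarrow> post (Suc k) \<noteq> []))"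
      using I by (intro process_token[OF input graph(2) m]) (simp_all add: I_def)
    then show "terminates xs process_token ?t r' (\<lambda>r'. I (Suc k) r' \<and> (r' TEST = 0 \<longleftrightarrow> Suc k < length toks))"
      unfolding pre post by (rule terminates_mono) (simp_all add: I_def take_Suc_conv_app_nth k)
  qed (use toks in simp)
  have finish: "terminates xs search_other (5 + 6 * m) r'
      (\<lambda>r. r FOUND \<noteq> 0 \<longleftrightarrow> (\<exists>u<m. u \<noteq> v \<and> snd (fold (process m E C) toks (0, \<lambda>_. 0)) u \<noteq> 0))"
    if "I (length toks) r'" for r'
    using that m by (intro search_other) (simp_all add: I_def)
  show "terminates xs (Repeat_While_Zero process_token TEST ;; search_other)
      (length toks * Suc ?t + (5 + 6 * m)) r
      (\<lambda>r. r FOUND \<noteq> 0 \<longleftrightarrow> (\<exists>u<m. u \<noteq> v \<and> snd (fold (process m E C) toks (0, \<lambda>_. 0)) u \<noteq> 0))"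
    by (rule terminates_Seq[OF loop finish]) simp_all
qed simp

section \<open>Position of the matrix and the coalition in the input\<close>

lemma length_matrix: "length (concat (map (\<lambda>i. map (f i) [0..<m]) [0..<n])) = n * m"
  by (simp add: length_concat comp_def sum_list_triv)

lemma nth_matrix:
  assumes "i < n" "j < m"
  shows "concat (map (\<lambda>i. map (f i) [0..<m]) [0..<n]) ! (i * m + j) = f i j"
  using assms
proof (induction n)
  case (Suc n)
  show ?case
  proof (cases "i = n")
    case True
    then show ?thesis
      using Suc.prems length_matrix[of f m n] by (simp add: nth_append)
  next
    case False
    then have "i < n"
      using Suc.prems by simp
    \<comment> \<open>Row \<open>i\<close> ends before the last row begins, so the entry lies in the
      part covered by the induction hypothesis.\<close>
    then have "Suc i * m \<le> n * m"
      by (intro mult_le_mono1) simp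
    then have "i * m + j < n * m"
      using Suc.prems by simp
    then show ?thesis
      using Suc.IH \<open>i < n\<close> Suc.prems length_matrix[of f m n] by (simp add: nth_append)
  qed
qed simp

lemma graph_input_encode:
  assumes "xs = encode_nat m @ (concat (map (\<lambda>i. map (\<lambda>j. (i, j) \<in> E) [0..<m]) [0..<m]) @
    map (\<lambda>i. i \<in> C) [0..<m]) @ rest"
  shows "graph_input m E C xs"
  unfolding graph_input_def
proof (intro conjI allI impI)
  let ?matrix = "concat (map (\<lambda>i. map (\<lambda>j. (i, j) \<in> E) [0..<m]) [0..<m])"
  note len = length_matrix[of "\<lambda>i j. (i, j) \<in> E" m m]
  fix a b
  assume ab: "a < m" "b < m"
  have "Suc a * m \<le> m * m"
    using ab by (intro mult_le_mono1) simp
  then have "a * m + b < length ?matrix"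
    using ab len by simp
  from input_symbol_segment[OF this, of "encode_nat m" "map (\<lambda>i. i \<in> C) [0..<m] @ rest"]
  show "input_symbol xs (Suc m + a * m + b) = of_bool ((a, b) \<in> E)"
    using nth_matrix[OF ab, of "\<lambda>i j. (i, j) \<in> E"] by (simp add: assms encode_nat_def ac_simps)
next
  note len = length_matrix[of "\<lambda>i j. (i, j) \<in> E" m m]
  fix b
  assume "b < m"
  then show "input_symbol xs (Suc m + m * m + b) = of_bool (b \<in> C)"
    using input_symbol_segment[of b "map (\<lambda>i. i \<in> C) [0..<m]"
      "encode_nat m @ concat (map (\<lambda>i. map (\<lambda>j. (i, j) \<in> E) [0..<m]) [0..<m])" rest] len
    by (simp add: assms encode_nat_def)
qed

text \<open>Every token has at least one bit; this bounds the rounds of the main loop by the length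
  of the input.\<close>

lemma length_tokens: "length (tokens c) \<le> length (encode_cup c)"
  by (induction c) auto

theorem theorem2:
  "\<exists>(prog :: instr list) (p :: nat poly).
     \<forall>(m :: nat) (E :: (nat \<times> nat) set) (C :: nat set) (c :: nat cup) (v :: nat).
       tournament {..<m} E \<and> cup_over {..<m} c \<and> C \<subseteq> {..<m} \<and> v \<in> {..<m} \<longrightarrow>
         (let input = encode_instance m E C c v in
            answers_within prog input (poly p (length input))
              (destructively_manipulable E C c v))"
proof (intro exI allI impI)
  fix m v :: nat and E :: "(nat \<times> nat) set" and C :: "nat set" and c :: "nat cup"
  assume asm: "tournament {..<m} E \<and> cup_over {..<m} c \<and> C \<subseteq> {..<m} \<and> v \<in> {..<m}"
  define xs where "xs = encode_instance m E C c v"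
  define graph where "graph = concat (map (\<lambda>i. map (\<lambda>j. (i, j) \<in> E) [0..<m]) [0..<m]) @
    map (\<lambda>i. i \<in> C) [0..<m]"
  have m: "0 < m"
    using asm by auto
  have c: "distinct (seeding c)" "set (seeding c) = {..<m}"
    using asm by (auto simp: cup_over_def)
  have xs: "xs = encode_nat m @ graph @ encode_nat v @ encode_cup c"
    by (simp add: xs_def graph_def encode_instance_def)
  have len: "length graph = m * m + m"
    using length_matrix[of "\<lambda>i j. (i, j) \<in> E" m m] by (simp add: graph_def)
  have input: "graph_input m E C xs"
    using xs unfolding graph_def by (rule graph_input_encode)
  let ?N = "length xs" and ?W = "possible_winners E C c"
  let ?t = "25 + 16 * m + 5 * v + length (tokens c) * (16 + 40 * (m * (m + 1)) + 5 * ?N)"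
  \<comment> \<open>On the empty stack, the whole cup leaves label 1 on its possible winners and 0
    on all other teams.\<close>
  have "(\<exists>u<m. u \<noteq> v \<and> snd (fold (process m E C) (tokens c) (0, \<lambda>_. 0)) u \<noteq> 0) \<longleftrightarrow> (\<exists>w \<in> ?W. w \<noteq> v)"
    using possible_winners_subset[of E C c] c(2) by (auto simp: process_tokens[OF c(1)])
  then have answer: "(\<exists>u<m. u \<noteq> v \<and> snd (fold (process m E C) (tokens c) (0, \<lambda>_. 0)) u \<noteq> 0) \<longleftrightarrow>
      destructively_manipulable E C c v"
    using destructively_manipulable_iff[of "{..<m}" E c C v] asm by simp
  have "answers_within (decision_program decide_manipulable FOUND) xs (?t + 2)
      (destructively_manipulable E C c v)"
    using decide_manipulable[OF xs[unfolded encode_cup_tokens] len input m tokens_neq_Nil[of c]]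
    unfolding answer by (rule answers_within_decision_program)
  \<comment> \<open>Matrix and coalition occupy \<open>m * m + m\<close> bits, so a token costs at
    most \<open>16 + 45 * N\<close> for input length \<open>N\<close>, and there are at most
    \<open>N\<close> tokens. Together with \<open>16 * m + 5 * v \<le> 21 * N\<close> the linear
    coefficient is \<open>16 + 21\<close>; the constant is \<open>25 + 2\<close>.\<close>
  moreover have "?t + 2 \<le> poly [:27, 37, 45:] ?N"
  proof -
    have N: "?N = Suc m + (m * m + m) + Suc v + length (encode_cup c)"
      by (simp add: xs len encode_nat_def)
    then have "length (tokens c) \<le> ?N" "16 + 40 * (m * (m + 1)) + 5 * ?N \<le> 16 + 45 * ?N" "m + v \<le> ?N"
      using length_tokens[of c] by simp_all
    then have "length (tokens c) * (16 + 40 * (m * (m + 1)) + 5 * ?N) \<le> ?N * (16 + 45 * ?N)"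
      and "16 * m + 5 * v \<le> 21 * ?N"
      by (auto intro: mult_le_mono)
    then show ?thesis
      by (simp add: algebra_simps)
  qed
  ultimately show "let input = encode_instance m E C c v in
      answers_within (decision_program decide_manipulable FOUND) input (poly [:27, 37, 45:] (length input))
        (destructively_manipulable E C c v)"
    unfolding Let_def xs_def[symmetric] by (rule answers_within_mono)
qed

end
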